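(* Under the assumptions (1)--(4) listed in the context, the temporal scheme described in the context (the bounds preserving Runge--Kutta scheme, with update $\mathbf u_i^{n+1}=\overline{\mathbf u}_i^{n+1}+\mathbf S_i$) preserves any linear invariant $Q(\mathbf u)$. Here a linear invariant is $Q(\mathbf u)=\mathbf c\cdot\mathbf u$ with $\mathbf c\in\mathbb R^m\setminus\{\mathbf 0\}$, and a scheme is said to preserve linear invariants for a periodic domain if $$\sum_{i\in V}m_iQ(\mathbf u_i^n)=\sum_{i\in V}m_iQ(\mathbf u_i^{n'})$$ for any linear invariant $Q(\mathbf u)$ and $n,n'\in\mathbb N$.
   Context: **Semidiscretization.** Consider a hyperbolic conservation law $\partial_t\mathbf u+\nabla\cdot\mathbf F(\mathbf u)=0$ on $\Omega\subset\mathbb R^d$, with solution $\mathbf u\in\mathbb R^m$ and flux $\mathbf F(\mathbf u)\in(\mathbb R^m)^d$. Let $\mathbf U_h(t)=\sum_{i\in V}\mathbf u_i(t)\phi_i(\mathbf x)$ be a discrete approximation of $\mathbf u$ via a basis $\{\phi_i\}_{i\in V}$ of a finite-dimensional vector space. The explicit semidiscretization is $$\partial_t\mathbf u_i\approx-\sum_{j\in\mathcal I(i)}\mathbf c_{ij}\cdot\mathbf F(\mathbf u_j)=\mathbf L(\mathbf u_i,t),\qquad i\in V,$$ where $\mathcal I(i)\subseteq V$ is the stencil at $i$ and $\mathbf c_{ij}$ is an $\mathbb R^d$-valued matrix dependent on the spatial discretization. The $m_i$ are positive quantities dependent on the spatial discretization such that $\sum_{i\in V}m_i\mathbf u_i^n\approx\int_\Omega\mathbf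 U_h(t^n)$. **Base Runge--Kutta (RK) method.** An explicit $s$-stage method with Butcher tableau $(A,b,c)$, $A\in\mathbb R^{s\times s}$ strictly lower triangular, $b,c\in\mathbb R^s$. Here $\mathbf u_i^n\approx\mathbf u_i(t^n)$ and $t^{n+1}=t^n+\Delta t$ for a time step $\Delta t>0$, $n\in\mathbb N$. **The scheme.** For the solution $\{\mathbf u_i^n\}_{i\in V}$ one has admissible sets $\mathcal B_i\subseteq\mathbb R^m$ (possibly different for each $i\in V$) and bijective mappings $\mathbf G_i:\mathcal B_i\to\mathbb R^m$ with Jacobian $\mathbf G_i'$. Put $\mathbf w_i^n=\mathbf G_i(\mathbf u_i^n)$ and $$\overline{\mathbf u}_{ij}^*=\mathbf G_i^{-1}\Big[\mathbf w_i^n+\Delta t\sum_{k=1}^sA_{jk}\mathbf G_i'(\overline{\mathbf u}_{ik}^* )\overline{\mathbf L}_{ik}\Big],\quad j\in\{1,\dots,s\},$$ $$\overline{\mathbf u}_i^{n+1}=\mathbf G_i^{-1}(\mathbf w_i^{n+1})=\mathbf G_i^{-1}\Big[\mathbf w_i^n+\Delta t\sum_{k=1}^sb_k\mathbf G_i'(\overline{\mathbf u}_{ik}^* )\overline{\mathbf L}_{ik}\Big],$$ with $\overline{\mathbf L}_{ik}=\mathbf L(\overline{\mathbf u}_{ik}^*,t^n+c_k\Delta t)$; $\overline{\mathbf u}_i^{n+1}$ is called the intermediate temporal update. The global mass defect is $\overline{\mathbf S}=\sum_{i\in V}m_i(\mathbf u_i^n-\overline{\mathbf u}_i^{n+1})$,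 and $\mathbf n=\overline{\mathbf S}/\|\overline{\mathbf S}\|_2$. For a set $X\subset\mathbb R^m$, the Euclidean distance from $\mathbf u\in X$ to the boundary $\partial X$ along a unit vector $\mathbf n$ is defined as $$D_X(\mathbf u,\mathbf n)=\underset{\gamma\ge0}{\mathrm{arg\,min}}\Big(\inf_{\mathbf x\in\partial X}\|\mathbf u+\gamma\mathbf n-\mathbf x\|_2\Big).$$ Set $\gamma_i^*=D_{\mathcal B_i}(\overline{\mathbf u}_i^{n+1},\mathbf n)$, $\gamma_i=\gamma_i^*\|\overline{\mathbf S}\|_2\big/\sum_{j\in V}m_j\gamma_j^*$, $\mathbf S_i=\gamma_i\mathbf n$. The temporal update is $\mathbf u_i^{n+1}=\overline{\mathbf u}_i^{n+1}+\mathbf S_i$. **Assumptions.** (1) There exists an open, quasiconvex, non-empty set $\mathcal B_i\subseteq\mathbb R^m$ for all $i\in V$ such that $\mathbf u_i^n\in\mathcal B_i$ for all $i\in V$. (2) There exists a bijective $C^\infty(\mathcal B_i)$ mapping $\mathbf G_i:\mathcal B_i\to\mathbb R^m$ such that for all $i\in V$ the intermediate temporal update results in $\overline{\mathbf u}_i^{n+1}\in\mathcal B_i$ if $\mathbf u_i^n\in\mathcal B_i$. (3) Periodic boundary conditions are enforced (i.e., $\Omega$ is a $d$-torus). (4) The underlying spatial discretization $\mathbf L(\mathbf u,t)$ preserves linear invariants, i.e., $\sum_{i\in V}m_iR(\mathbf u_i^n,\mathbf u_i^{n'})=0$ for any $n,n'$, where $R(\mathbf u,\mathbf u')=Q(\mathbf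 u)-Q(\mathbf u')=Q(\mathbf u-\mathbf u')$ is the residual of a linear invariant $Q$.
   Formalization: Assumes the minimizers γ_i^* exist and Σ_j m_jγ_j^* ≠ 0 whenever S̄ ≠ 0 (else γ_i is 0/0, which (1)–(4) allow, e.g. B_i=(0,∞), n=+1); if S̄ = 0 the correction S_i is 0. Assumption (4) is read as a property of exact solutions of the semidiscrete system. *)

theory Defs
  imports "HOL-Analysis.Analysis"
begin

section \<open>Geometry of the admissible sets\<close>

text \<open>Length of a curve: supremum of the lengths of inscribed polygons (infinite if the curve is
  not rectifiable).\<close>

definition path_length :: "(real \<Rightarrow> 'a::metric_space) \<Rightarrow> ennreal" where
  "path_length g =
     (SUP ts \<in> {ts. sorted ts \<and> set ts \<subseteq> {0..1}}.
        \<Sum>k<length ts - 1. ennreal (dist (g (ts ! k)) (g (ts ! Suc k))))"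

text \<open>Quasiconvexity in the sense of metric geometry; convex sets are the case \<open>C = 1\<close> in
  Euclidean space.\<close>

definition quasiconvex :: "'a::metric_space set \<Rightarrow> bool" where
  "quasiconvex X \<longleftrightarrow>
     (\<exists>C\<ge>1. \<forall>x\<in>X. \<forall>y\<in>X. \<exists>g. path g \<and> path_image g \<subseteq> X \<and> pathstart g = x \<and> pathfinish g = y \<and>
        path_length g \<le> ennreal (C * dist x y))"

text \<open>\<open>C\<^sup>k\<close> and \<open>C\<^sup>\<infinity>\<close> through iterated directional derivatives; only meaningful for open \<open>S\<close>,
  since the derivatives are taken in the whole space.\<close>

primrec Ck_on :: "nat \<Rightarrow> 'a::real_normed_vector set \<Rightarrow> ('a \<Rightarrow> 'b::real_normed_vector) \<Rightarrow> bool" where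
  "Ck_on 0 S f \<longleftrightarrow> continuous_on S f"
| "Ck_on (Suc k) S f \<longleftrightarrow>
     (\<forall>x\<in>S. f differentiable (at x)) \<and> (\<forall>v. Ck_on k S (\<lambda>x. frechet_derivative f (at x) v))"

definition Cinf_on :: "'a::real_normed_vector set \<Rightarrow> ('a \<Rightarrow> 'b::real_normed_vector) \<Rightarrow> bool" where
  "Cinf_on S f \<longleftrightarrow> (\<forall>k. Ck_on k S f)"

text \<open>\<open>\<gamma>\<close> is a value of \<open>D\<^sub>X(u, \<nu>)\<close>, the arg min over \<open>\<gamma> \<ge> 0\<close> of \<open>inf {norm (u + \<gamma> \<nu> - x) | x \<in> \<partial>X}\<close>.
  A minimizer need not be unique (the ray may meet the boundary repeatedly) and need not exist,
  hence a relation. If \<open>\<partial>X\<close> is empty, \<open>infdist\<close> is constantly 0 and every \<open>\<gamma> \<ge> 0\<close> is a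
  minimizer, just as for the convention \<open>inf \<emptyset> = \<infinity>\<close>.\<close>

definition is_boundary_distance ::
    "'a::real_normed_vector set \<Rightarrow> 'a \<Rightarrow> 'a \<Rightarrow> real \<Rightarrow> bool" where
  "is_boundary_distance X u \<nu> \<gamma> \<longleftrightarrow>
     is_arg_min (\<lambda>\<gamma>. infdist (u + \<gamma> *\<^sub>R \<nu>) (frontier X)) (\<lambda>\<gamma>. \<gamma> \<ge> 0) \<gamma>"


section \<open>Semidiscretization on the torus\<close>

text \<open>The torus is the quotient of \<open>\<real>\<^sup>d\<close> by the lattice spanned by the columns of an invertible
  matrix \<open>P\<close> (diagonal for a box with opposite faces identified); functions on the torus are
  the \<open>P\<close>-periodic functions on \<open>\<real>\<^sup>d\<close>.\<close>

definition periodic_on_torus :: "real^'d^'d \<Rightarrow> (real^'d \<Rightarrow> real) \<Rightarrow> bool" where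
  "periodic_on_torus P f \<longleftrightarrow> (\<forall>k x. f (x + column k P) = f x)"

definition independent_functions :: "'v set \<Rightarrow> ('v \<Rightarrow> 'x \<Rightarrow> real) \<Rightarrow> bool" where
  "independent_functions V \<phi> \<longleftrightarrow>
     (\<forall>a. (\<forall>x. (\<Sum>i\<in>V. a i * \<phi> i x) = 0) \<longrightarrow> (\<forall>i\<in>V. a i = 0))"

text \<open>Right-hand side \<open>L\<close> at node \<open>i\<close>: the sum over \<open>j\<close> in the stencil of \<open>c\<^sub>i\<^sub>j \<cdot> F(u\<^sub>j)\<close>, with
  \<open>c\<^sub>i\<^sub>j \<in> \<real>\<^sup>d\<close> contracted with the \<open>d\<close> components of the flux. It depends on the whole state
  \<open>U\<close> through the stencil; the time argument is kept for the notation \<open>L(u, t)\<close> only.\<close>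

definition semidiscrete_rhs ::
    "('v \<Rightarrow> 'v set) \<Rightarrow> ('v \<Rightarrow> 'v \<Rightarrow> real^'d) \<Rightarrow> (real^'m \<Rightarrow> (real^'m)^'d)
      \<Rightarrow> 'v \<Rightarrow> ('v \<Rightarrow> real^'m) \<Rightarrow> real \<Rightarrow> real^'m" where
  "semidiscrete_rhs stencil cc F i U \<tau> =
     - (\<Sum>j\<in>stencil i. \<Sum>k\<in>UNIV. (cc i j $ k) *\<^sub>R (F (U j) $ k))"

definition semidiscrete_solution ::
    "'v set \<Rightarrow> ('v \<Rightarrow> (real^'m) set) \<Rightarrow> ('v \<Rightarrow> ('v \<Rightarrow> real^'m) \<Rightarrow> real \<Rightarrow> real^'m)
      \<Rightarrow> real set \<Rightarrow> (real \<Rightarrow> 'v \<Rightarrow> real^'m) \<Rightarrow> bool" where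
  "semidiscrete_solution V B L T U \<longleftrightarrow>
     (\<forall>\<tau>\<in>T. \<forall>i\<in>V. U \<tau> i \<in> B i \<and>
        ((\<lambda>\<sigma>. U \<sigma> i) has_vector_derivative L i (U \<tau>) \<tau>) (at \<tau> within T))"


section \<open>Linear invariants\<close>

definition linear_invariant :: "(real^'m \<Rightarrow> real) \<Rightarrow> bool" where
  "linear_invariant Q \<longleftrightarrow> (\<exists>c. c \<noteq> 0 \<and> Q = (\<lambda>u. c \<bullet> u))"

definition residual :: "(real^'m \<Rightarrow> real) \<Rightarrow> real^'m \<Rightarrow> real^'m \<Rightarrow> real" where
  "residual Q u u' = Q u - Q u'"

definition scheme_preserves_linear_invariants ::
    "'v set \<Rightarrow> ('v \<Rightarrow> real) \<Rightarrow> (nat \<Rightarrow> 'v \<Rightarrow> real^'m) \<Rightarrow> bool" where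
  "scheme_preserves_linear_invariants V m u \<longleftrightarrow>
     (\<forall>Q. linear_invariant Q \<longrightarrow>
        (\<forall>n n'. (\<Sum>i\<in>V. m i * Q (u n i)) = (\<Sum>i\<in>V. m i * Q (u n' i))))"

text \<open>The same property for the spatial discretization \<open>L\<close> alone, that is, for the exact solutions
  of the system of ordinary differential equations before any time integrator is applied,
  sampled at the times \<open>t\<^sup>n\<close>. Solutions may exist only locally, so arbitrary intervals \<open>T\<close> are
  allowed.\<close>

definition spatial_preserves_linear_invariants ::
    "'v set \<Rightarrow> ('v \<Rightarrow> real) \<Rightarrow> ('v \<Rightarrow> (real^'m) set) \<Rightarrow> (nat \<Rightarrow> real)
      \<Rightarrow> ('v \<Rightarrow> ('v \<Rightarrow> real^'m) \<Rightarrow> real \<Rightarrow> real^'m) \<Rightarrow> bool" where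
  "spatial_preserves_linear_invariants V m B t L \<longleftrightarrow>
     (\<forall>Q T U. linear_invariant Q \<longrightarrow> is_interval T \<longrightarrow> semidiscrete_solution V B L T U \<longrightarrow>
        (\<forall>n n'. t n \<in> T \<longrightarrow> t n' \<in> T \<longrightarrow>
           (\<Sum>i\<in>V. m i * residual Q (U (t n) i) (U (t n') i)) = 0))"

end

theory Submission
  imports Defs
begin

text \<open>The correction \<open>\<gamma> n i *\<^sub>R \<nu> n\<close> hands back exactly the mass
  lost by the intermediate update. The normalization of \<open>\<gamma>\<close> makes its
  \<open>m\<close>-weighted sum equal to \<open>norm (Sbar n)\<close>, so the weighted corrections
  add up to \<open>norm (Sbar n) *\<^sub>R \<nu> n\<close>, which is the defect
  (\<open>defect_redistribution\<close>). Hence each step conserves the vector-valued total mass,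
  and every linear functional of it is conserved too.\<close>

lemma linear_invariants_preserved_if_mass_constant:
  fixes u :: "nat \<Rightarrow> 'v \<Rightarrow> real^'m"
  assumes step: "\<And>n. (\<Sum>i\<in>V. m i *\<^sub>R u (Suc n) i) = (\<Sum>i\<in>V. m i *\<^sub>R u n i)"
  shows "scheme_preserves_linear_invariants V m u"
  unfolding scheme_preserves_linear_invariants_def linear_invariant_def
proof (intro allI impI, elim exE conjE)
  fix Q :: "real^'m \<Rightarrow> real" and n n' :: nat and q :: "real^'m"
  assume Q: "Q = (\<lambda>x. q \<bullet> x)"
  \<comment> \<open>Time 0 serves as a common reference, so \<open>n\<close> and \<open>n'\<close>
    need not be ordered.\<close>
  have mass: "(\<Sum>i\<in>V. m i *\<^sub>R u k i) = (\<Sum>i\<in>V. m i *\<^sub>R u 0 i)" for k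
    by (induction k) (simp_all add: step)
  have "(\<Sum>i\<in>V. m i * Q (u k i)) = q \<bullet> (\<Sum>i\<in>V. m i *\<^sub>R u 0 i)" for k
    unfolding mass[of k, symmetric] by (simp add: Q inner_sum_right)
  then show "(\<Sum>i\<in>V. m i * Q (u n i)) = (\<Sum>i\<in>V. m i * Q (u n' i))"
    by simp
qed

text \<open>The quotients \<open>m i * g i / (\<Sum>j\<in>V. m j * g j)\<close> sum to one, so they
  split \<open>S\<close> into shares along its own direction. The denominator matters only for
  nonzero \<open>S\<close>; for \<open>S = 0\<close> both sides vanish.\<close>

lemma defect_redistribution:
  fixes S :: "'a::real_normed_vector" and m g :: "'v \<Rightarrow> real"
  assumes "S \<noteq> 0 \<Longrightarrow> (\<Sum>j\<in>V. m j * g j) \<noteq> 0"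
  shows "(\<Sum>i\<in>V. m i *\<^sub>R (g i * norm S / (\<Sum>j\<in>V. m j * g j)) *\<^sub>R (1 / norm S) *\<^sub>R S) = S"
proof (cases "S = 0")
  case False
  let ?M = "\<Sum>j\<in>V. m j * g j"
  have "(\<Sum>i\<in>V. m i *\<^sub>R (g i * norm S / ?M) *\<^sub>R (1 / norm S) *\<^sub>R S)
      = (\<Sum>i\<in>V. (m i * g i / ?M) *\<^sub>R S)"
    \<comment> \<open>Here \<open>norm S\<close> cancels against the factor that makes the direction
      a unit vector.\<close>
    using False by (intro sum.cong) simp_all
  also have "\<dots> = (?M / ?M) *\<^sub>R S"
    by (simp only: scaleR_left.sum sum_divide_distrib)
  also have "\<dots> = S"
    using assms False by simp
  finally show ?thesis .
qed simp

theorem theorem3p2: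
  fixes V :: "'v set" and m :: "'v \<Rightarrow> real"
    and P :: "real^'d^'d" and \<phi> :: "'v \<Rightarrow> real^'d \<Rightarrow> real"
    and stencil :: "'v \<Rightarrow> 'v set" and cc :: "'v \<Rightarrow> 'v \<Rightarrow> real^'d"
    and F :: "real^'m \<Rightarrow> (real^'m)^'d"
    and L :: "'v \<Rightarrow> ('v \<Rightarrow> real^'m) \<Rightarrow> real \<Rightarrow> real^'m"
    and s :: nat and A :: "nat \<Rightarrow> nat \<Rightarrow> real" and b c :: "nat \<Rightarrow> real"
    and t :: "nat \<Rightarrow> real" and dt :: real
    and B :: "'v \<Rightarrow> (real^'m) set" and G :: "'v \<Rightarrow> real^'m \<Rightarrow> real^'m"
    and u ubar :: "nat \<Rightarrow> 'v \<Rightarrow> real^'m"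
    and ustar Lbar :: "nat \<Rightarrow> nat \<Rightarrow> 'v \<Rightarrow> real^'m"
    and Sbar \<nu> :: "nat \<Rightarrow> real^'m"
    and \<gamma>star \<gamma> :: "nat \<Rightarrow> 'v \<Rightarrow> real"
  (* spatial discretization *)
  assumes V: "finite V"
    and mass_pos: "\<forall>i\<in>V. m i > 0"
    and basis: "independent_functions V \<phi>"
    and stencil: "\<forall>i\<in>V. stencil i \<subseteq> V"
    and L_def: "L = semidiscrete_rhs stencil cc F"
  (* base Runge-Kutta method and time grid *)
    and explicit: "\<forall>j\<in>{1..s}. \<forall>k\<in>{1..s}. j \<le> k \<longrightarrow> A j k = 0"
    and dt_pos: "dt > 0"
    and time_grid: "\<forall>n. t (Suc n) = t n + dt"
  (* admissible sets *)
    and B: "\<forall>i\<in>V. open (B i) \<and> quasiconvex (B i) \<and> B i \<noteq> {}"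
    and u_in_B: "\<forall>n. \<forall>i\<in>V. u n i \<in> B i"
  (* bijections onto the whole space *)
    and G: "\<forall>i\<in>V. bij_betw (G i) (B i) UNIV \<and> Cinf_on (B i) (G i)"
    and ubar_in_B: "\<forall>n. \<forall>i\<in>V. u n i \<in> B i \<longrightarrow> ubar (Suc n) i \<in> B i"
  (* periodic boundary conditions *)
    and torus: "invertible P" "\<forall>i\<in>V. periodic_on_torus P (\<phi> i)"
  (* conservation by the spatial discretization *)
    and spatial: "spatial_preserves_linear_invariants V m B t L"
  (* the scheme: stages, intermediate update, mass defect, correction; if Sbar n = 0 the correction is 0 *)
    and Lbar: "\<forall>n. \<forall>i\<in>V. \<forall>k\<in>{1..s}. Lbar n k i = L i (ustar n k) (t n + c k * dt)"
    and stages: "\<forall>n. \<forall>i\<in>V. \<forall>j\<in>{1..s}. ustar n j i =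
          inv_into (B i) (G i) (G i (u n i) +
            dt *\<^sub>R (\<Sum>k=1..s. A j k *\<^sub>R (jacobian (G i) (at (ustar n k i)) *v Lbar n k i)))"
    and intermediate: "\<forall>n. \<forall>i\<in>V. ubar (Suc n) i =
          inv_into (B i) (G i) (G i (u n i) +
            dt *\<^sub>R (\<Sum>k=1..s. b k *\<^sub>R (jacobian (G i) (at (ustar n k i)) *v Lbar n k i)))"
    and Sbar: "\<forall>n. Sbar n = (\<Sum>i\<in>V. m i *\<^sub>R (u n i - ubar (Suc n) i))"
    and normal: "\<forall>n. \<nu> n = (1 / norm (Sbar n)) *\<^sub>R Sbar n"
    and \<gamma>star: "\<forall>n. \<forall>i\<in>V. is_boundary_distance (B i) (ubar (Suc n) i) (\<nu> n) (\<gamma>star n i)"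
    and \<gamma>: "\<forall>n. \<forall>i\<in>V. \<gamma> n i = \<gamma>star n i * norm (Sbar n) / (\<Sum>j\<in>V. m j * \<gamma>star n j)"
    and \<gamma>_well_defined: "\<forall>n. Sbar n \<noteq> 0 \<longrightarrow> (\<Sum>j\<in>V. m j * \<gamma>star n j) \<noteq> 0"
    and update: "\<forall>n. \<forall>i\<in>V. u (Suc n) i = ubar (Suc n) i + \<gamma> n i *\<^sub>R \<nu> n"
  shows "scheme_preserves_linear_invariants V m u"
proof (rule linear_invariants_preserved_if_mass_constant)
  fix n
  have "(\<Sum>i\<in>V. m i *\<^sub>R u (Suc n) i)
      = (\<Sum>i\<in>V. m i *\<^sub>R ubar (Suc n) i) + (\<Sum>i\<in>V. m i *\<^sub>R \<gamma> n i *\<^sub>R \<nu> n)"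
    by (simp add: update scaleR_right_distrib sum.distrib del: scaleR_scaleR)
  \<comment> \<open>Keeping the scalings nested preserves the shape in
    \<open>defect_redistribution\<close>. If \<open>Sbar n = 0\<close>, then
    \<open>\<nu> n = 0\<close> and the correction vanishes.\<close>
  also have "(\<Sum>i\<in>V. m i *\<^sub>R \<gamma> n i *\<^sub>R \<nu> n) = Sbar n"
    using defect_redistribution[of "Sbar n" m "\<gamma>star n" V] \<gamma>_well_defined
    by (simp add: \<gamma> normal del: scaleR_scaleR cong: sum.cong)
  \<comment> \<open>The defect is old mass minus intermediate mass, so the intermediate mass
    cancels.\<close>
  also have "(\<Sum>i\<in>V. m i *\<^sub>R ubar (Suc n) i) + Sbar n = (\<Sum>i\<in>V. m i *\<^sub>R u n i)"
    by (simp add: Sbar scaleR_right_diff_distrib sum_subtractf)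
  finally show "(\<Sum>i\<in>V. m i *\<^sub>R u (Suc n) i) = (\<Sum>i\<in>V. m i *\<^sub>R u n i)" .
qed

end
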